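(* Let $\mathsf{A}$ be a $C^*$-algebra with representation $(\pi,\mathsf{h})$ and character $\chi$, and let $\delta:\mathsf{A}\to|\mathsf{h}\rangle$ be a $(\pi,\chi)$-derivation. Then $\delta$ is inner.
   Context: Representations are *-representations on Hilbert spaces; a character is a nonzero multiplicative linear functional; $|\mathsf{h}\rangle:=B(\mathbb{C};\mathsf{h})$. No boundedness of $\delta$ is assumed. A $(\pi,\chi)$-derivation is a linear map $\delta:\mathsf{A}\to B(\mathbb{C};\mathsf{h})$ satisfying $\delta(ab)=\delta(a)\chi(b)+\pi(a)\delta(b)$ for all $a,b\in\mathsf{A}$; it is inner if there is $T\in B(\mathbb{C};\mathsf{h})$ such that $\delta(a)=\pi(a)T-T\chi(a)$ for all $a\in\mathsf{A}$. *)

theory Defs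
  imports "HOL-Analysis.Analysis"
begin

class scaleC =
  fixes scaleC :: "complex \<Rightarrow> 'a \<Rightarrow> 'a"  (infixr "*\<^sub>C" 75)

class complex_vector = real_vector + scaleC +
  assumes scaleC_add_right: "c *\<^sub>C (x + y) = c *\<^sub>C x + c *\<^sub>C y"
    and scaleC_add_left: "(c + d) *\<^sub>C x = c *\<^sub>C x + d *\<^sub>C x"
    and scaleC_scaleC: "c *\<^sub>C (d *\<^sub>C x) = (c * d) *\<^sub>C x"
    and scaleC_one: "1 *\<^sub>C x = x"
    and scaleR_scaleC: "r *\<^sub>R x = complex_of_real r *\<^sub>C x"

global_interpretation complex_vector:
  vector_space "scaleC :: complex \<Rightarrow> 'a::complex_vector \<Rightarrow> 'a"
  by unfold_locales
    (simp_all add: scaleC_add_right scaleC_add_left scaleC_scaleC scaleC_one)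

abbreviation clinear :: "('a::complex_vector \<Rightarrow> 'b::complex_vector) \<Rightarrow> bool" where
  "clinear \<equiv> Vector_Spaces.linear scaleC scaleC"

class complex_normed_vector = complex_vector + real_normed_vector +
  assumes norm_scaleC: "norm (c *\<^sub>C x) = cmod c * norm x"

text \<open>The inner product is conjugate-linear in the first and linear in the second argument.\<close>

class complex_inner = complex_normed_vector +
  fixes cinner :: "'a \<Rightarrow> 'a \<Rightarrow> complex"
  assumes cinner_commute: "cinner x y = cnj (cinner y x)"
    and cinner_add_right: "cinner x (y + z) = cinner x y + cinner x z"
    and cinner_scaleC_right: "cinner x (c *\<^sub>C y) = c * cinner x y"
    and cinner_self: "cinner x x = complex_of_real ((norm x)\<^sup>2)"

class chilbert_space = complex_inner + complete_space

text \<open>No unit is required.\<close>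

class cstar_algebra = complex_normed_vector + real_normed_algebra + complete_space +
  fixes star :: "'a \<Rightarrow> 'a"
  assumes mult_scaleC_left: "(c *\<^sub>C a) * b = c *\<^sub>C (a * b)"
    and mult_scaleC_right: "a * (c *\<^sub>C b) = c *\<^sub>C (a * b)"
    and star_star: "star (star a) = a"
    and star_add: "star (a + b) = star a + star b"
    and star_scaleC: "star (c *\<^sub>C a) = cnj c *\<^sub>C star a"
    and star_mult: "star (a * b) = star b * star a"
    and cstar_identity: "norm (star a * a) = (norm a)\<^sup>2"

instantiation complex :: chilbert_space
begin
definition scaleC_complex :: "complex \<Rightarrow> complex \<Rightarrow> complex" where
  "scaleC_complex c z = c * z"
definition cinner_complex :: "complex \<Rightarrow> complex \<Rightarrow> complex" where
  "cinner_complex z w = cnj z * w"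
instance
proof
  fix c d x y z :: complex and r :: real
  show "cinner x x = complex_of_real ((norm x)\<^sup>2)"
    by (simp only: cinner_complex_def complex_norm_square mult.commute)
qed (simp_all add: scaleC_complex_def cinner_complex_def algebra_simps norm_mult scaleR_conv_of_real)
end

instantiation complex :: cstar_algebra
begin
definition star_complex :: "complex \<Rightarrow> complex" where
  "star_complex = cnj"
instance
  by standard (simp_all add: scaleC_complex_def star_complex_def norm_mult power2_eq_square)
end

definition bounded_clinear :: "('a::complex_normed_vector \<Rightarrow> 'b::complex_normed_vector) \<Rightarrow> bool" where
  "bounded_clinear f \<longleftrightarrow> bounded_linear f \<and> (\<forall>c x. f (c *\<^sub>C x) = c *\<^sub>C f x)"

typedef (overloaded) ('a, 'b) cblinfun (\<open>(_ \<Rightarrow>\<^sub>C\<^sub>L /_)\<close> [22, 21] 21) =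
  "{f :: 'a::complex_normed_vector \<Rightarrow> 'b::complex_normed_vector. bounded_clinear f}"
  morphisms cblinfun_apply CBlinfun
proof
  show "(\<lambda>_. 0) \<in> {f :: 'a \<Rightarrow> 'b. bounded_clinear f}"
    by (simp add: bounded_clinear_def)
qed

setup_lifting type_definition_cblinfun

instantiation cblinfun :: (complex_normed_vector, complex_normed_vector) complex_vector
begin

lift_definition zero_cblinfun :: "'a \<Rightarrow>\<^sub>C\<^sub>L 'b" is "\<lambda>_. 0"
  by (simp add: bounded_clinear_def)

lift_definition plus_cblinfun :: "('a \<Rightarrow>\<^sub>C\<^sub>L 'b) \<Rightarrow> ('a \<Rightarrow>\<^sub>C\<^sub>L 'b) \<Rightarrow> 'a \<Rightarrow>\<^sub>C\<^sub>L 'b"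
  is "\<lambda>f g x. f x + g x"
  by (simp add: bounded_clinear_def bounded_linear_add scaleC_add_right)

lift_definition minus_cblinfun :: "('a \<Rightarrow>\<^sub>C\<^sub>L 'b) \<Rightarrow> ('a \<Rightarrow>\<^sub>C\<^sub>L 'b) \<Rightarrow> 'a \<Rightarrow>\<^sub>C\<^sub>L 'b"
  is "\<lambda>f g x. f x - g x"
  by (simp add: bounded_clinear_def bounded_linear_sub
      complex_vector.scale_right_diff_distrib)

lift_definition uminus_cblinfun :: "('a \<Rightarrow>\<^sub>C\<^sub>L 'b) \<Rightarrow> 'a \<Rightarrow>\<^sub>C\<^sub>L 'b" is "\<lambda>f x. - f x"
  by (simp add: bounded_clinear_def bounded_linear_minus)

lemma bounded_clinear_scaleC:
  assumes "bounded_clinear f"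
  shows "bounded_clinear (\<lambda>x. c *\<^sub>C f x :: 'b::complex_normed_vector)"
proof -
  have "bounded_linear (\<lambda>y::'b. c *\<^sub>C y)"
    by (rule bounded_linear_intro[where K = "cmod c"])
      (simp_all add: scaleC_add_right scaleR_scaleC scaleC_scaleC norm_scaleC mult.commute)
  with assms show ?thesis
    by (simp add: bounded_clinear_def bounded_linear_compose scaleC_scaleC mult.commute)
qed

lift_definition scaleC_cblinfun :: "complex \<Rightarrow> ('a \<Rightarrow>\<^sub>C\<^sub>L 'b) \<Rightarrow> 'a \<Rightarrow>\<^sub>C\<^sub>L 'b" is "\<lambda>c f x. c *\<^sub>C f x"
  by (rule bounded_clinear_scaleC)

lift_definition scaleR_cblinfun :: "real \<Rightarrow> ('a \<Rightarrow>\<^sub>C\<^sub>L 'b) \<Rightarrow> 'a \<Rightarrow>\<^sub>C\<^sub>L 'b" is "\<lambda>r f x. r *\<^sub>R f x"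
  by (simp add: scaleR_scaleC bounded_clinear_scaleC)

instance
proof
qed (transfer; simp add: fun_eq_iff add.assoc add.commute scaleC_add_right scaleC_add_left
    scaleC_scaleC scaleR_scaleC)+

end

lift_definition cblinfun_compose ::
  "('b::complex_normed_vector \<Rightarrow>\<^sub>C\<^sub>L 'c::complex_normed_vector) \<Rightarrow>
    ('a::complex_normed_vector \<Rightarrow>\<^sub>C\<^sub>L 'b) \<Rightarrow> 'a \<Rightarrow>\<^sub>C\<^sub>L 'c"  (infixl "o\<^sub>C" 67)
  is "\<lambda>f g. f \<circ> g"
  by (simp add: bounded_clinear_def bounded_linear_compose o_def)

definition is_adjoint :: "('h::chilbert_space \<Rightarrow>\<^sub>C\<^sub>L 'h) \<Rightarrow> ('h \<Rightarrow>\<^sub>C\<^sub>L 'h) \<Rightarrow> bool" where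
  "is_adjoint S T \<longleftrightarrow>
    (\<forall>x y. cinner (cblinfun_apply S x) y = cinner x (cblinfun_apply T y))"

text \<open>Representations are not assumed to be nondegenerate.\<close>

definition star_representation ::
  "('a::cstar_algebra \<Rightarrow> ('h::chilbert_space \<Rightarrow>\<^sub>C\<^sub>L 'h)) \<Rightarrow> bool" where
  "star_representation \<pi> \<longleftrightarrow>
    clinear \<pi> \<and> (\<forall>a b. \<pi> (a * b) = \<pi> a o\<^sub>C \<pi> b) \<and> (\<forall>a. is_adjoint (\<pi> a) (\<pi> (star a)))"

definition character :: "('a::cstar_algebra \<Rightarrow> complex) \<Rightarrow> bool" where
  "character chi \<longleftrightarrow>
    clinear chi \<and> (\<forall>a b. chi (a * b) = chi a * chi b) \<and> (\<exists>a. chi a \<noteq> 0)"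

text \<open>
  In a product such as \<open>\<delta>(a) chi(b)\<close> the number \<open>chi(b)\<close> is an operator on the one-dimensional space,
  so that composing with it on the right is scalar multiplication. No continuity of \<open>\<delta>\<close> is required.
\<close>

definition derivation ::
  "('a::cstar_algebra \<Rightarrow> ('h::chilbert_space \<Rightarrow>\<^sub>C\<^sub>L 'h)) \<Rightarrow> ('a \<Rightarrow> complex) \<Rightarrow>
    ('a \<Rightarrow> (complex \<Rightarrow>\<^sub>C\<^sub>L 'h)) \<Rightarrow> bool" where
  "derivation \<pi> chi \<delta> \<longleftrightarrow>
    clinear \<delta> \<and> (\<forall>a b. \<delta> (a * b) = chi b *\<^sub>C \<delta> a + \<pi> a o\<^sub>C \<delta> b)"

definition inner_derivation ::
  "('a::cstar_algebra \<Rightarrow> ('h::chilbert_space \<Rightarrow>\<^sub>C\<^sub>L 'h)) \<Rightarrow> ('a \<Rightarrow> complex) \<Rightarrow>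
    ('a \<Rightarrow> (complex \<Rightarrow>\<^sub>C\<^sub>L 'h)) \<Rightarrow> bool" where
  "inner_derivation \<pi> chi \<delta> \<longleftrightarrow> (\<exists>T. \<forall>a. \<delta> a = \<pi> a o\<^sub>C T - chi a *\<^sub>C T)"

end

theory Submission
  imports Defs
begin

text \<open>
  Let \<open>K\<close> be the kernel of the character and \<open>D a = \<delta> a 1\<close>, a vector of the Hilbert space. On \<open>K\<close> the
  derivation rule reduces to \<open>D (a b) = \<pi> a (D b)\<close>, so \<open>D\<close> is a left module map there, and the
  essential claim is that such a map is evaluation at a vector: \<open>D a = \<pi> a T\<close> on \<open>K\<close>
  (\<open>inner_on_kernel\<close>). The passage from \<open>K\<close> to the whole algebra, which is one dimension larger, is
  linear algebra (\<open>inner_on_algebra\<close>).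

  \<^emph>\<open>Continuity.\<close> A null sequence in \<open>K\<close> can be written as \<open>a\<^sub>n = c\<^sub>n d\<close> with a common right factor
  \<open>d \<in> K\<close> and bounded \<open>c\<^sub>n\<close>; this is Cohen factorization (\<open>null_sequence_factorization\<close>). Then
  \<open>D a\<^sub>n = \<pi> c\<^sub>n (D d)\<close> is bounded, since representations are contractive (\<open>p_contractive\<close>), and so
  \<open>D\<close> is bounded on \<open>K\<close> (\<open>D_bounded_on_kernel\<close>).

  \<^emph>\<open>The vector.\<close> If \<open>T\<close> exists, it may be taken in the closure of \<open>\<pi>(K)\<close> applied to the Hilbert space,
  and then \<open>D u = \<pi> u T\<close> tends to \<open>T\<close> along an approximate unit of \<open>K\<close>, its norm approaching a
  supremum. Conversely, choose self-adjoint \<open>u\<^sub>n \<in> K\<close> between \<open>0\<close> and \<open>1\<close> for which the norm of \<open>D u\<^sub>n\<close>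
  tends to the supremum over all such elements. Given \<open>u\<close> and \<open>v\<close> with \<open>u v\<close> close to \<open>u\<close>, the vector
  \<open>D u\<close> is close to \<open>\<pi> u (D v)\<close>, and \<open>0 \<le> u \<le> 1\<close> bounds the squared distance from \<open>\<xi>\<close> to \<open>\<pi> u \<xi>\<close>
  by the drop in squared norm. Near the supremum there is no room for a drop, so \<open>D u\<^sub>n\<close> is close to
  \<open>D v\<close> for every sufficiently good \<open>v\<close>. Hence the sequence is Cauchy, its limit is \<open>T\<close>, and no
  weak compactness is needed even when \<open>K\<close> is not separable.

  \<^emph>\<open>Approximate units without functional calculus.\<close> Both parts use elements that almost act as a
  right unit on finitely many elements of \<open>K\<close> (\<open>cutoff_exists\<close>). For \<open>h = a* a\<close> and a small imaginary
  \<open>k\<close>, the element \<open>y = (h + k)\<^sup>-\<^sup>1 h\<close> does this for \<open>a\<close>. It is \<open>(1 + U)/2\<close> for the Cayley transform \<open>U\<close>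
  of \<open>h\<close>, and the unitarity of \<open>U\<close> is the identity \<open>2 y* y = y + y*\<close>, which supplies all estimates.
  Finite sets are handled by multiplying the contractions \<open>1 - y\<close>. Neither spectral theory nor the
  positivity of sums of elements \<open>a* a\<close> enters, and inverses in the unitization are replaced by
  fixed points of affine contractions of the algebra.
\<close>

section \<open>Fixed points and geometric convergence\<close>

instance cstar_algebra \<subseteq> banach ..
instance chilbert_space \<subseteq> banach ..

lemma affine_fixpoint:
  fixes f :: "'a::banach \<Rightarrow> 'a"
  assumes "0 \<le> c" "c < 1" and "\<And>x y. norm (f x - f y) \<le> c * norm (x - y)"
  obtains x where "f x = x"
proof -
  have "\<forall>x y. dist (f x) (f y) \<le> c * dist x y"
    using assms(3) by (simp add: dist_norm)
  then have "\<exists>!x. f x = x"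
    by (rule banach_fix_type[OF assms(1,2)])
  then show thesis using that by blast
qed

lemma geometric_increments:
  fixes x :: "nat \<Rightarrow> 'a::banach"
  assumes inc: "\<And>k. norm (x (Suc k) - x k) \<le> B * (1/2)^k"
  obtains l where "x \<longlonglongrightarrow> l" and "norm (l - x 0) \<le> 2 * B"
proof -
  have geom: "(\<lambda>k. B * (1/2)^k) sums (B * 2)"
    using sums_mult[OF geometric_sums[of "1/2::real"], of B] by simp
  have sm: "summable (\<lambda>k. x (Suc k) - x k)"
    by (rule summable_comparison_test'[OF sums_summable[OF geom]]) (simp add: inc)
  have part: "(\<Sum>k<n. x (Suc k) - x k) = x n - x 0" for n
    by (rule sum_lessThan_telescope)
  have "(\<lambda>n. x n - x 0) \<longlonglongrightarrow> (\<Sum>k. x (Suc k) - x k)"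
    using summable_LIMSEQ[OF sm] by (simp add: part)
  then have "(\<lambda>n. x n - x 0 + x 0) \<longlonglongrightarrow> (\<Sum>k. x (Suc k) - x k) + x 0"
    by (intro tendsto_add tendsto_const)
  then have lim: "x \<longlonglongrightarrow> (\<Sum>k. x (Suc k) - x k) + x 0" by simp
  have "norm (\<Sum>k. x (Suc k) - x k) \<le> (\<Sum>k. B * (1/2)^k)"
    by (rule norm_suminf_le[OF inc sums_summable[OF geom]])
  then show thesis
    by (intro that[OF lim]) (simp add: sums_unique[OF geom, symmetric])
qed

section \<open>Elementary C*-algebra\<close>

lemma star_zero: "star (0::'a::cstar_algebra) = 0"
  using star_add[of "0::'a" 0] by simp

lemma star_minus: "star (- a) = - star (a::'a::cstar_algebra)"
  using star_add[of a "- a"] by (simp add: star_zero add_eq_0_iff)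

lemma star_diff: "star (a - b) = star a - star (b::'a::cstar_algebra)"
  using star_add[of a "- b"] by (simp add: star_minus)

lemma norm_star: "norm (star a) = norm (a::'a::cstar_algebra)"
proof -
  have le: "norm b \<le> norm (star b)" for b :: 'a
  proof (cases "b = 0")
    case False
    have "norm b * norm b \<le> norm (star b) * norm b"
      using cstar_identity[of b] norm_mult_ineq[of "star b" b] by (simp add: power2_eq_square)
    with False show ?thesis by simp
  qed (simp add: star_zero)
  show ?thesis
    using le[of a] le[of "star a"] by (simp add: star_star)
qed

lemma norm_le_of_star_square:
  fixes a :: "'a::cstar_algebra"
  assumes "norm (star a * a) \<le> r\<^sup>2" "0 \<le> r"
  shows "norm a \<le> r"
proof -
  have "(norm a)\<^sup>2 \<le> r\<^sup>2" using assms(1) by (simp only: cstar_identity)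
  then show ?thesis using assms(2) by (rule power2_le_imp_le)
qed

text \<open>
  The multiplier norm is invariant under the adjoint because \<open>u* u = x* (1 - z) u\<close> for
  \<open>u = (1 - z*) x\<close>.
\<close>

lemma multiplier_adjoint_contraction:
  fixes z :: "'a::cstar_algebra"
  assumes z: "\<And>x. norm (x - z * x) \<le> norm x"
  shows "norm (x - star z * x) \<le> norm x"
proof (cases "x - star z * x = 0")
  case False
  let ?u = "x - star z * x"
  have "star ?u * ?u = star x * (?u - z * ?u)"
    by (simp add: star_diff star_mult star_star algebra_simps)
  then have "(norm ?u)\<^sup>2 \<le> norm x * norm (?u - z * ?u)"
    using norm_mult_ineq[of "star x" "?u - z * ?u"] by (simp add: cstar_identity[symmetric] norm_star)
  also have "\<dots> \<le> norm x * norm ?u"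
    by (intro mult_left_mono z) simp
  finally show ?thesis using False by (simp add: power2_eq_square)
qed simp

lemma multiplier_right_contraction:
  fixes z :: "'a::cstar_algebra"
  assumes z: "\<And>x. norm (x - z * x) \<le> norm x"
  shows "norm (x - x * z) \<le> norm x" and "norm (x - x * star z) \<le> norm x"
proof -
  have "norm (star (x - x * z)) \<le> norm (star x)"
    using multiplier_adjoint_contraction[OF z, of "star x"] by (simp add: star_diff star_mult)
  then show "norm (x - x * z) \<le> norm x" by (simp only: norm_star)
  have "norm (star (x - x * star z)) \<le> norm (star x)"
    using z[of "star x"] by (simp add: star_diff star_mult star_star)
  then show "norm (x - x * star z) \<le> norm x" by (simp only: norm_star)
qed

section \<open>Cayley transforms\<close>

text \<open>The identity says that \<open>2 y - 1\<close> is an isometry in the unitization, \<open>(2 y - 1)* (2 y - 1) = 1\<close>.\<close>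

definition cayley :: "'a::cstar_algebra \<Rightarrow> bool" where
  "cayley y \<longleftrightarrow> star y * y + star y * y = y + star y"

text \<open>
  Evaluate \<open>y* h y\<close> with the equation for \<open>h y\<close> and with its adjoint for \<open>y* h\<close>; as \<open>k\<close> is imaginary,
  comparing the results leaves \<open>2 k y* y = k (y + y*)\<close>.
\<close>

lemma cayley_resolvent:
  fixes h y :: "'a::cstar_algebra"
  assumes h: "star h = h" and k: "cnj k = - k" "k \<noteq> 0" and y: "h * y + k *\<^sub>C y = h"
  shows "cayley y"
proof -
  have hy: "h * y = h - k *\<^sub>C y" using y by (simp add: algebra_simps)
  have "star (h * y + k *\<^sub>C y) = h" using y h by simp
  then have yh: "star y * h = h + k *\<^sub>C star y"
    by (simp add: star_add star_mult star_scaleC h k algebra_simps)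
  have 1: "star y * (h * y) = star y * h - k *\<^sub>C (star y * y)"
    by (simp add: hy algebra_simps mult_scaleC_right)
  have 2: "star y * h * y = h * y + k *\<^sub>C (star y * y)"
    by (simp add: yh algebra_simps mult_scaleC_left)
  have "star y * h - k *\<^sub>C (star y * y) = h * y + k *\<^sub>C (star y * y)"
    by (metis 1 2 mult.assoc)
  then have "k *\<^sub>C (star y * y) + k *\<^sub>C (star y * y) = k *\<^sub>C y + k *\<^sub>C star y"
    unfolding yh hy by (simp add: algebra_simps)
  then have "k *\<^sub>C (star y * y + star y * y) = k *\<^sub>C (y + star y)"
    by (simp add: scaleC_add_right)
  with k show ?thesis by (simp add: cayley_def)
qed

lemma cayley_norm:
  assumes "cayley (y::'a::cstar_algebra)" shows "norm y \<le> 1"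
proof (cases "y = 0")
  case False
  have "2 * (norm y)\<^sup>2 = norm (star y * y + star y * y)"
    by (simp flip: scaleR_2 add: cstar_identity)
  also have "\<dots> = norm (y + star y)"
    using assms by (simp add: cayley_def)
  also have "\<dots> \<le> 2 * norm y"
    using norm_triangle_ineq[of y "star y"] by (simp add: norm_star)
  finally show ?thesis using False by (simp add: power2_eq_square)
qed simp

text \<open>\<open>1 - y\<close> is the average of \<open>1\<close> and the isometry \<open>1 - 2 y\<close>.\<close>

lemma cayley_contraction:
  assumes "cayley (y::'a::cstar_algebra)" shows "norm (x - y * x) \<le> norm x"
proof -
  let ?u = "x - y * x - y * x"
  have "star ?u * ?u = star x * x - star x * (y + star y) * x - star x * (y + star y) * x
      + star x * (star y * y + star y * y) * x + star x * (star y * y + star y * y) * x"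
    by (simp add: star_diff star_add star_mult algebra_simps)
  then have "star ?u * ?u = star x * x"
    using assms by (simp add: cayley_def)
  then have "(norm ?u)\<^sup>2 = (norm x)\<^sup>2"
    by (metis cstar_identity)
  then have u: "norm ?u = norm x" by simp
  have "x + ?u = 2 *\<^sub>R (x - y * x)" by (simp add: scaleR_2)
  then have "2 * norm (x - y * x) = norm (x + ?u)" by simp
  also have "\<dots> \<le> 2 * norm x"
    using norm_triangle_ineq[of x ?u] u by simp
  finally show ?thesis by simp
qed

lemma resolvent_exists_large:
  fixes h :: "'a::cstar_algebra"
  assumes k: "norm h < cmod k"
  shows "\<exists>y. h * y + k *\<^sub>C y = h"
proof -
  have k0: "k \<noteq> 0" using k by auto
  obtain y where y: "inverse k *\<^sub>C (h - h * y) = y"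
  proof (rule affine_fixpoint)
    show "0 \<le> norm h / cmod k" by simp
    show "norm h / cmod k < 1" using k k0 by simp
    fix x z :: 'a
    have "inverse k *\<^sub>C (h - h * x) - inverse k *\<^sub>C (h - h * z) = inverse k *\<^sub>C (h * (z - x))"
      by (simp add: algebra_simps)
    then have "norm (inverse k *\<^sub>C (h - h * x) - inverse k *\<^sub>C (h - h * z))
        = norm (h * (z - x)) / cmod k"
      by (simp only: norm_scaleC norm_inverse) (simp add: field_simps)
    also have "\<dots> \<le> norm h * norm (z - x) / cmod k"
      by (intro divide_right_mono norm_mult_ineq) simp
    finally show "norm (inverse k *\<^sub>C (h - h * x) - inverse k *\<^sub>C (h - h * z))
        \<le> norm h / cmod k * norm (x - z)"
      by (simp add: norm_minus_commute)
  qed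
  have "k *\<^sub>C y = k *\<^sub>C (inverse k *\<^sub>C (h - h * y))" using y by simp
  also have "\<dots> = h - h * y" using k0 by (simp add: scaleC_scaleC scaleC_one)
  finally show ?thesis by (intro exI[of _ y]) simp
qed

text \<open>
  Since \<open>1 - y = k (h + k)\<^sup>-\<^sup>1\<close> is a contraction however small \<open>k\<close> is, a Neumann series about \<open>k\<close> always
  reaches \<open>k/2\<close>: multiplying \<open>(h + k/2) x = h\<close> by \<open>(h + k)\<^sup>-\<^sup>1\<close> gives \<open>x = y + (1 - y) x / 2\<close>. This is
  how the reality of the spectrum of \<open>h\<close> is used.
\<close>

lemma resolvent_halve:
  fixes h y :: "'a::cstar_algebra"
  assumes h: "star h = h" and k: "cnj k = - k" "k \<noteq> 0" and y: "h * y + k *\<^sub>C y = h"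
  shows "\<exists>y. h * y + (k / 2) *\<^sub>C y = h"
proof -
  have con: "norm (x - y * x) \<le> norm x" for x
    by (rule cayley_contraction[OF cayley_resolvent[OF h k y]])
  obtain x where x: "y + (1/2) *\<^sub>C (x - y * x) = x"
  proof (rule affine_fixpoint)
    fix x z :: 'a
    have "y + (1/2) *\<^sub>C (x - y * x) - (y + (1/2) *\<^sub>C (z - y * z)) = (1/2) *\<^sub>C ((x - z) - y * (x - z))"
      by (simp add: algebra_simps)
    then show "norm (y + (1/2) *\<^sub>C (x - y * x) - (y + (1/2) *\<^sub>C (z - y * z))) \<le> 1/2 * norm (x - z)"
      using con[of "x - z"] by (simp add: norm_scaleC)
  qed simp_all
  have inv: "h * (x - y * x) + k *\<^sub>C (x - y * x) = k *\<^sub>C x"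
  proof -
    have "h * (x - y * x) + k *\<^sub>C (x - y * x) = h * x + k *\<^sub>C x - (h * y + k *\<^sub>C y) * x"
      by (simp add: algebra_simps mult_scaleC_left)
    then show ?thesis by (simp add: y)
  qed
  have "h * x + k *\<^sub>C x = (h * y + k *\<^sub>C y) + (1/2) *\<^sub>C (h * (x - y * x) + k *\<^sub>C (x - y * x))"
    by (subst (1 2) x[symmetric])
      (simp add: distrib_left scaleC_add_right mult_scaleC_right scaleC_scaleC mult.commute)
  then have "h * x + k *\<^sub>C x = h + (k / 2) *\<^sub>C x"
    by (simp add: y inv scaleC_scaleC)
  moreover have "k *\<^sub>C x = (k / 2) *\<^sub>C x + (k / 2) *\<^sub>C x"
    by (simp flip: scaleC_add_left)
  ultimately show ?thesis by (intro exI[of _ x]) simp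
qed

lemma resolvent_exists_small:
  fixes h :: "'a::cstar_algebra"
  assumes h: "star h = h" and e: "0 < e"
  obtains k y where "cnj k = - k" "k \<noteq> 0" "cmod k < e" "h * y + k *\<^sub>C y = h"
proof -
  define r where "r n = (norm h + 1) / 2 ^ n" for n :: nat
  define k where "k n = \<i> * complex_of_real (r n)" for n
  have r: "r n > 0" for n by (simp add: r_def add_nonneg_pos)
  have k: "cnj (k n) = - k n" "k n \<noteq> 0" "cmod (k n) = r n" for n
    using r[of n] by (simp_all add: k_def norm_mult)
  have ex: "\<exists>y. h * y + k n *\<^sub>C y = h" for n
  proof (induction n)
    case 0
    show ?case by (rule resolvent_exists_large) (simp add: k(3) r_def)
  next
    case (Suc n)
    have "k (Suc n) = k n / 2" by (simp add: k_def r_def field_simps)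
    moreover obtain y where "h * y + k n *\<^sub>C y = h" using Suc by blast
    ultimately show ?case using resolvent_halve[OF h k(1,2)] by metis
  qed
  have "r \<longlonglongrightarrow> 0"
    unfolding r_def by (rule LIMSEQ_divide_realpow_zero) simp
  then have "eventually (\<lambda>n. r n < e) sequentially"
    using e by (rule order_tendstoD)
  then obtain n where "r n < e" by (auto simp: eventually_sequentially)
  with that k ex show thesis by metis
qed

text \<open>
  With \<open>h = a* a\<close> the C*-identity turns \<open>a (1 - y)\<close> into \<open>(1 - y*) h (1 - y)\<close>, and \<open>h (1 - y) = k y\<close>
  is as small as \<open>k\<close>. The resolvent equation is kept in the conclusion because it forces
  multiplicative functionals that vanish at \<open>h\<close> to vanish at \<open>y\<close>.
\<close>

lemma approximate_right_unit:
  fixes a :: "'a::cstar_algebra"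
  assumes e: "0 < e"
  obtains k y where "cayley y" "norm (a - a * y) \<le> e"
    "k \<noteq> 0" "star a * a * y + k *\<^sub>C y = star a * a"
proof -
  let ?h = "star a * a"
  have h: "star ?h = ?h" by (simp add: star_mult star_star)
  obtain k y where k: "cnj k = - k" "k \<noteq> 0" "cmod k < e\<^sup>2" and y: "?h * y + k *\<^sub>C y = ?h"
    using resolvent_exists_small[OF h, of "e\<^sup>2"] e by auto
  have c: "cayley y" by (rule cayley_resolvent[OF h k(1,2) y])
  let ?w = "?h - ?h * y"
  have w: "?w = k *\<^sub>C y" using y by (simp add: algebra_simps)
  have "star (a - a * y) * (a - a * y) = ?w - star y * ?w"
    by (simp add: star_diff star_mult algebra_simps)
  then have "norm (star (a - a * y) * (a - a * y)) \<le> norm ?w"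
    using multiplier_adjoint_contraction[OF cayley_contraction[OF c], of ?w] by simp
  also have "\<dots> = cmod k * norm y" by (simp add: w norm_scaleC)
  also have "\<dots> \<le> e\<^sup>2 * 1"
    using k(3) cayley_norm[OF c] by (intro mult_mono) auto
  finally have "norm (star (a - a * y) * (a - a * y)) \<le> e\<^sup>2" by simp
  then have "norm (a - a * y) \<le> e"
    by (rule norm_le_of_star_square) (use e in simp)
  with that c k(2) y show thesis by blast
qed

section \<open>Representations together with a multiplicative functional\<close>

lemma cinner_add_left: "cinner (x + y) z = cinner x z + cinner y (z::'a::complex_inner)"
  by (metis cinner_add_right cinner_commute complex_cnj_add)

lemma norm_add_square:
  fixes x y :: "'a::complex_inner"
  shows "(norm (x + y))\<^sup>2 = (norm x)\<^sup>2 + 2 * Re (cinner x y) + (norm y)\<^sup>2"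
proof -
  have "Re (cinner (x + y) (x + y)) = Re (cinner x x) + Re (cinner x y) + Re (cinner y x) + Re (cinner y y)"
    by (simp add: cinner_add_left cinner_add_right)
  moreover have "Re (cinner y x) = Re (cinner x y)"
    by (subst cinner_commute) simp
  ultimately show ?thesis by (simp add: cinner_self)
qed

lemma cinner_minus_right: "cinner x (- y) = - cinner x (y::'a::complex_inner)"
  using cinner_add_right[of x y "- y"] cinner_add_right[of x 0 0] by (simp add: add_eq_0_iff)

lemma cinner_diff_right: "cinner x (y - z) = cinner x y - cinner x (z::'a::complex_inner)"
  using cinner_add_right[of x y "- z"] by (simp add: cinner_minus_right)

lemma norm_diff_square:
  fixes x y :: "'a::complex_inner"
  shows "(norm (x - y))\<^sup>2 = (norm x)\<^sup>2 - 2 * Re (cinner x y) + (norm y)\<^sup>2"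
  using norm_add_square[of x "- y"] by (simp add: cinner_minus_right)

lemma Re_cinner_le:
  fixes x y :: "'a::complex_inner"
  shows "Re (cinner x y) \<le> norm x * norm y"
proof -
  have "(norm (x + y))\<^sup>2 \<le> (norm x + norm y)\<^sup>2"
    by (intro power_mono norm_triangle_ineq) simp
  then show ?thesis by (simp add: norm_add_square power2_sum)
qed

lemma Re_cinner_self: "Re (cinner x x) = (norm (x::'a::complex_inner))\<^sup>2"
  by (simp add: cinner_self)

text \<open>
  Operators are plain functions here, so that vectors can be computed with directly.
\<close>

locale rep_with_functional =
  fixes p :: "'a::cstar_algebra \<Rightarrow> 'h::chilbert_space \<Rightarrow> 'h"
    and chi :: "'a \<Rightarrow> complex"
  assumes p_bounded: "bounded_linear (p a)"
    and p_add: "p (a + b) \<xi> = p a \<xi> + p b \<xi>"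
    and p_scaleC: "p (c *\<^sub>C a) \<xi> = c *\<^sub>C p a \<xi>"
    and p_mult: "p (a * b) \<xi> = p a (p b \<xi>)"
    and p_adjoint: "cinner (p a \<xi>) \<eta> = cinner \<xi> (p (star a) \<eta>)"
    and chi_add: "chi (a + b) = chi a + chi b"
    and chi_scaleC: "chi (c *\<^sub>C a) = c * chi a"
    and chi_mult: "chi (a * b) = chi a * chi b"
begin

lemma p_diff: "p (a - b) \<xi> = p a \<xi> - p b \<xi>"
  using p_add[of "a - b" b] by (simp add: algebra_simps)

lemma chi_diff: "chi (a - b) = chi a - chi b"
  using chi_add[of "a - b" b] by (simp add: algebra_simps)

lemma p_scaleR: "p (r *\<^sub>R a) \<xi> = r *\<^sub>R p a \<xi>"
  by (simp add: scaleR_scaleC p_scaleC)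

lemma chi_scaleR: "chi (r *\<^sub>R a) = complex_of_real r * chi a"
  by (simp add: scaleR_scaleC chi_scaleC)

lemma p_vec_diff: "p a (\<xi> - \<eta>) = p a \<xi> - p a \<eta>"
  by (rule linear_diff[OF bounded_linear.linear[OF p_bounded]])

lemma p_adjoint': "cinner (p (star a) \<xi>) \<eta> = cinner \<xi> (p a \<eta>)"
  using p_adjoint[of "star a"] by (simp add: star_star)

text \<open>
  Otherwise some \<open>b\<close> of norm below \<open>1\<close> has \<open>chi b = 1\<close>, and \<open>chi\<close> maps the solution of \<open>x = b + b x\<close>
  to a number satisfying \<open>t = 1 + t\<close>.
\<close>

lemma chi_contractive: "cmod (chi a) \<le> norm a"
proof (rule ccontr)
  assume "\<not> cmod (chi a) \<le> norm a"
  then have lt: "norm a < cmod (chi a)" by simp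
  then have c0: "chi a \<noteq> 0" by auto
  define b where "b = inverse (chi a) *\<^sub>C a"
  have b: "chi b = 1" using c0 by (simp add: b_def chi_scaleC)
  have "norm b = norm a / cmod (chi a)"
    by (simp add: b_def norm_scaleC norm_inverse divide_inverse mult.commute)
  then have nb: "norm b < 1" using lt c0 by simp
  obtain x where x: "b + b * x = x"
  proof (rule affine_fixpoint[of "norm b" "\<lambda>x. b + b * x"])
    fix x y
    have "b + b * x - (b + b * y) = b * (x - y)" by (simp add: algebra_simps)
    then show "norm (b + b * x - (b + b * y)) \<le> norm b * norm (x - y)"
      by (simp add: norm_mult_ineq)
  qed (use nb in auto)
  have "chi (b + b * x) = 1 + chi x" by (simp add: chi_add chi_mult b)
  with x show False by simp
qed

lemma chi_bounded_linear: "bounded_linear chi"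
  by (rule bounded_linear_intro[of chi 1])
    (simp_all add: chi_add chi_scaleR chi_contractive scaleR_conv_of_real)

text \<open>
  The norm \<open>M\<close> of an operator \<open>S\<close> is nearly attained at vectors on which \<open>1 - S* S / M\<^sup>2\<close> is nearly
  zero. If \<open>M\<close> exceeded the norm of \<open>a\<close>, then \<open>1 - a* a / M\<^sup>2\<close> would have a left inverse \<open>1 + b\<close> in the
  unitization, so its image would be bounded below. In the proof, \<open>below\<close> and \<open>gap\<close> are the two
  sides of this conflict, and together they improve \<open>M\<close> to the smaller bound \<open>q\<close>.
\<close>

lemma p_contractive: "norm (p a \<xi>) \<le> norm a * norm \<xi>"
proof -
  define M where "M = onorm (p a)"
  have M0: "0 \<le> M" unfolding M_def by (rule onorm_pos_le[OF p_bounded])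
  have M: "norm (p a \<eta>) \<le> M * norm \<eta>" for \<eta>
    unfolding M_def by (rule onorm[OF p_bounded])
  have Mstar: "norm (p (star a) \<eta>) \<le> M * norm \<eta>" for \<eta>
  proof (cases "p (star a) \<eta> = 0")
    case False
    let ?\<zeta> = "p (star a) \<eta>"
    have "(norm ?\<zeta>)\<^sup>2 = Re (cinner \<eta> (p a ?\<zeta>))"
      by (simp flip: Re_cinner_self p_adjoint')
    also have "\<dots> \<le> norm \<eta> * norm (p a ?\<zeta>)" by (rule Re_cinner_le)
    also have "\<dots> \<le> norm \<eta> * (M * norm ?\<zeta>)" by (intro mult_left_mono M) simp
    finally show ?thesis using False by (simp add: power2_eq_square mult.commute)
  qed (use M0 in simp)
  have "M \<le> norm a"
  proof (rule ccontr)
    assume "\<not> M \<le> norm a"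
    then have lt: "norm a < M" and Mpos: "0 < M"
      using norm_ge_zero[of a] by linarith+
    define g where "g = (1 / M\<^sup>2) *\<^sub>R (star a * a)"
    have "(norm a)\<^sup>2 < M\<^sup>2" using lt by (intro power_strict_mono) auto
    then have g: "norm g < 1"
      using Mpos by (simp add: g_def cstar_identity divide_simps)
    obtain b where b: "g + b * g = b"
    proof (rule affine_fixpoint[of "norm g" "\<lambda>x. g + x * g"])
      fix x y
      have "g + x * g - (g + y * g) = (x - y) * g" by (simp add: algebra_simps)
      then show "norm (g + x * g - (g + y * g)) \<le> norm g * norm (x - y)"
        using norm_mult_ineq[of "x - y" g] by (simp add: mult.commute[of "norm g"])
    qed (use g in auto)
    define L where "L = 1 + onorm (p b)"
    have L: "1 \<le> L" unfolding L_def using onorm_pos_le[OF p_bounded[of b]] by simp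
    have below: "norm \<eta> \<le> L * norm (\<eta> - p g \<eta>)" for \<eta>
    proof -
      have "p b \<eta> = p g \<eta> + p b (p g \<eta>)"
        by (subst b[symmetric]) (simp add: p_add p_mult)
      then have "\<eta> = (\<eta> - p g \<eta>) + p b (\<eta> - p g \<eta>)"
        by (simp add: p_vec_diff)
      then have "norm \<eta> \<le> norm (\<eta> - p g \<eta>) + norm (p b (\<eta> - p g \<eta>))"
        by (metis norm_triangle_ineq)
      also have "\<dots> \<le> norm (\<eta> - p g \<eta>) + onorm (p b) * norm (\<eta> - p g \<eta>)"
        by (intro add_left_mono onorm[OF p_bounded])
      finally show ?thesis by (simp add: L_def algebra_simps)
    qed
    have gap: "M\<^sup>2 * (norm (\<eta> - p g \<eta>))\<^sup>2 \<le> M\<^sup>2 * (norm \<eta>)\<^sup>2 - (norm (p a \<eta>))\<^sup>2" for \<eta>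
    proof -
      let ?n = "(norm (p a \<eta>))\<^sup>2"
      have pg: "p g \<eta> = (1 / M\<^sup>2) *\<^sub>R p (star a) (p a \<eta>)"
        by (simp add: g_def p_scaleR p_mult)
      have "p (star a) (p a \<eta>) = M\<^sup>2 *\<^sub>R p g \<eta>" using Mpos by (simp add: pg)
      then have "?n = M\<^sup>2 * Re (cinner \<eta> (p g \<eta>))"
        using p_adjoint[of a \<eta> "p a \<eta>"]
        by (simp flip: Re_cinner_self add: scaleR_scaleC cinner_scaleC_right)
      moreover have "M\<^sup>2 * (norm (p g \<eta>))\<^sup>2 \<le> ?n"
      proof -
        have "norm (p g \<eta>) \<le> (1 / M\<^sup>2) * (M * norm (p a \<eta>))"
          using Mstar[of "p a \<eta>"] Mpos by (simp add: pg divide_right_mono)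
        then have "M * norm (p g \<eta>) \<le> norm (p a \<eta>)"
          using Mpos by (simp add: power2_eq_square field_simps)
        then have "(M * norm (p g \<eta>))\<^sup>2 \<le> ?n" using Mpos by (intro power_mono) auto
        then show ?thesis by (simp add: power_mult_distrib)
      qed
      ultimately show ?thesis by (simp add: norm_diff_square algebra_simps)
    qed
    define q where "q = M * sqrt (1 - 1 / L\<^sup>2)"
    have L2: "1 / L\<^sup>2 \<le> 1" using L by (simp add: one_le_power)
    have "norm (p a \<eta>) \<le> q * norm \<eta>" for \<eta>
    proof -
      have "(norm \<eta>)\<^sup>2 \<le> L\<^sup>2 * (norm (\<eta> - p g \<eta>))\<^sup>2"
        using power_mono[OF below[of \<eta>], of 2] by (simp add: power_mult_distrib)
      then have "(norm \<eta>)\<^sup>2 / L\<^sup>2 \<le> (norm (\<eta> - p g \<eta>))\<^sup>2"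
        using L by (simp add: divide_le_eq mult.commute)
      then have "M\<^sup>2 * ((norm \<eta>)\<^sup>2 / L\<^sup>2) \<le> M\<^sup>2 * (norm (\<eta> - p g \<eta>))\<^sup>2"
        by (intro mult_left_mono) auto
      with gap[of \<eta>] have "(norm (p a \<eta>))\<^sup>2 \<le> M\<^sup>2 * (1 - 1 / L\<^sup>2) * (norm \<eta>)\<^sup>2"
        by (simp add: algebra_simps)
      also have "\<dots> = (q * norm \<eta>)\<^sup>2"
        using L2 by (simp add: q_def power_mult_distrib)
      finally show ?thesis
        by (rule power2_le_imp_le) (use L2 Mpos in \<open>simp add: q_def\<close>)
    qed
    moreover have "0 \<le> q" using L2 Mpos by (simp add: q_def)
    ultimately have "M \<le> q" unfolding M_def by (intro onorm_bound)
    moreover have "sqrt (1 - 1 / L\<^sup>2) < 1"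
      using L by simp
    then have "q < M" unfolding q_def using Mpos by simp
    ultimately show False by simp
  qed
  then show ?thesis
    using M[of \<xi>] mult_right_mono[of M "norm a" "norm \<xi>"] by simp
qed

section \<open>Approximate units in the kernel\<close>

text \<open>
  Elements \<open>z\<close> whose complement \<open>1 - z\<close> is a contraction both on the algebra and on the Hilbert space.
  Unlike \<open>cayley\<close>, this is preserved when complements are multiplied. The value at \<open>star z\<close> is recorded
  because \<open>z\<close> is symmetrized later.
\<close>

definition damping :: "'a \<Rightarrow> bool" where
  "damping z \<longleftrightarrow> chi z = 0 \<and> chi (star z) = 0 \<and> (\<forall>x. norm (x - z * x) \<le> norm x) \<and> (\<forall>\<xi>. norm (\<xi> - p z \<xi>) \<le> norm \<xi>)"

text \<open>
  Taking the expectation of \<open>2 y* y = y + y*\<close> at \<open>\<xi>\<close> makes \<open>p y \<xi>\<close> orthogonal, in the real inner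
  product, to \<open>\<xi> - p y \<xi>\<close>.
\<close>

lemma cayley_hilbert_contraction:
  assumes "cayley y" shows "norm (\<xi> - p y \<xi>) \<le> norm \<xi>"
proof -
  let ?u = "p y \<xi>"
  have "2 * Re (cinner \<xi> (p (star y * y) \<xi>)) = 2 * Re (cinner \<xi> (p y \<xi>))"
  proof -
    have "Re (cinner \<xi> (p (star y) \<xi>)) = Re (cinner \<xi> (p y \<xi>))"
      by (subst p_adjoint[symmetric], subst cinner_commute) simp
    moreover have "Re (cinner \<xi> (p (star y * y + star y * y) \<xi>)) = Re (cinner \<xi> (p (y + star y) \<xi>))"
      using assms by (simp add: cayley_def)
    then have "Re (cinner \<xi> (p (star y * y) \<xi>)) + Re (cinner \<xi> (p (star y * y) \<xi>))
        = Re (cinner \<xi> (p y \<xi>)) + Re (cinner \<xi> (p (star y) \<xi>))"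
      by (simp only: p_add cinner_add_right plus_complex.sel)
    ultimately show ?thesis by simp
  qed
  then have "(norm ?u)\<^sup>2 = Re (cinner \<xi> ?u)"
    by (simp add: p_mult flip: p_adjoint Re_cinner_self)
  then have "(norm (\<xi> - ?u))\<^sup>2 = (norm \<xi>)\<^sup>2 - (norm ?u)\<^sup>2"
    by (simp add: norm_diff_square)
  then have "(norm (\<xi> - ?u))\<^sup>2 \<le> (norm \<xi>)\<^sup>2" by simp
  then show ?thesis by (rule power2_le_imp_le) simp
qed

lemma damping_single:
  assumes a: "chi (star a * a) = 0" and e: "0 < e"
  obtains y where "damping y" "norm (a - a * y) \<le> e"
proof -
  obtain k y where y: "cayley y" "norm (a - a * y) \<le> e" "k \<noteq> 0"
    "star a * a * y + k *\<^sub>C y = star a * a"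
    by (rule approximate_right_unit[OF e])
  have "chi (star a * a * y + k *\<^sub>C y) = 0" by (simp only: y(4) a)
  then have "k * chi y = 0" by (simp only: chi_add chi_scaleC chi_mult[of "star a * a"] a) simp
  then have "chi y = 0" using y(3) by simp
  moreover have "chi (star y * y + star y * y) = chi (y + star y)"
    using y(1) by (simp add: cayley_def)
  \<comment> \<open>Apart from \<open>chi (star y)\<close>, every term of this identity contains the vanishing factor \<open>chi y\<close>.\<close>
  ultimately have "chi y = 0" "chi (star y) = 0"
    by (simp_all add: chi_add chi_mult)
  with y that cayley_contraction[OF y(1)] cayley_hilbert_contraction[OF y(1)] show thesis
    by (auto simp: damping_def)
qed

lemma damping_zero: "damping 0"
  using p_add[of 0 0] chi_add[of 0 0] by (simp add: damping_def star_zero)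

text \<open>The complement of \<open>z + y - z y\<close> is \<open>(1 - z) (1 - y)\<close>.\<close>

lemma damping_join:
  assumes z: "damping z" and y: "damping y"
  shows "damping (z + y - z * y)"
proof -
  have "norm (x - (z + y - z * y) * x) \<le> norm x" for x
  proof -
    have "x - (z + y - z * y) * x = (x - y * x) - z * (x - y * x)"
      by (simp add: algebra_simps)
    then show ?thesis using z y unfolding damping_def by (metis order_trans)
  qed
  moreover have "norm (\<xi> - p (z + y - z * y) \<xi>) \<le> norm \<xi>" for \<xi>
  proof -
    have "\<xi> - p (z + y - z * y) \<xi> = (\<xi> - p y \<xi>) - p z (\<xi> - p y \<xi>)"
      by (simp add: p_add p_diff p_mult p_vec_diff)
    then show ?thesis using z y unfolding damping_def by (metis order_trans)
  qed
  ultimately show ?thesis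
    using z y by (simp add: damping_def star_add star_diff star_mult chi_add chi_diff chi_mult)
qed

text \<open>
  A further element \<open>a\<close> is treated by choosing \<open>y\<close> for \<open>a (1 - z)\<close> and passing to \<open>(1 - z) (1 - y)\<close>;
  the right factor \<open>1 - y\<close> is a contraction and does not spoil the earlier estimates. Applying the
  construction once to the sum of all \<open>a* a\<close> would require that this sum dominates each term in norm.
\<close>

lemma damping_finite:
  assumes "finite F" and "\<And>a. a \<in> F \<Longrightarrow> chi (star a * a) = 0" and e: "0 < e"
  shows "\<exists>z. damping z \<and> (\<forall>a\<in>F. norm (a - a * z) \<le> e)"
  using assms(1,2)
proof (induction F)
  case empty
  show ?case using damping_zero by blast
next
  case (insert a F)
  then obtain z where z: "damping z" and zF: "\<And>b. b \<in> F \<Longrightarrow> norm (b - b * z) \<le> e" by blast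
  let ?a = "a - a * z"
  have "chi (star a) * chi a = 0" using insert.prems[of a] by (simp add: chi_mult)
  then have "chi (star ?a * ?a) = 0"
    using z by (auto simp: damping_def star_diff star_mult chi_mult chi_diff)
  then obtain y where y: "damping y" and ya: "norm (?a - ?a * y) \<le> e"
    using damping_single e by blast
  let ?w = "z + y - z * y"
  have factor: "b - b * ?w = (b - b * z) - (b - b * z) * y" for b
    by (simp add: algebra_simps)
  have "norm (b - b * ?w) \<le> e" if "b \<in> F" for b
    using multiplier_right_contraction(1)[of y "b - b * z"] y zF[OF that]
    unfolding factor damping_def by fastforce
  with ya damping_join[OF z y] show ?case
    by (intro exI[of _ ?w]) (simp add: factor)
qed

text \<open>
  The last condition is \<open>e\<^sup>2 \<le> e\<close> in the representation, that is, \<open>0 \<le> e \<le> 1\<close> there.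
\<close>

definition cutoff :: "'a \<Rightarrow> bool" where
  "cutoff e \<longleftrightarrow> chi e = 0 \<and> star e = e \<and> norm e \<le> 2 \<and> (\<forall>x. norm (x - e * x) \<le> norm x)
    \<and> (\<forall>\<xi>. (norm (p e \<xi>))\<^sup>2 \<le> Re (cinner \<xi> (p e \<xi>)))"

lemma cutoff_right: "cutoff e \<Longrightarrow> norm (x - x * e) \<le> norm x"
  by (rule multiplier_right_contraction) (simp add: cutoff_def)

text \<open>
  The complement of the symmetrized element is \<open>(1 - z) (1 - z)*\<close>, which is positive, and a contraction
  because \<open>1 - z\<close> is one.
\<close>

lemma cutoff_of_damping:
  assumes z: "damping z"
  shows "cutoff (z + star z - z * star z)" (is "cutoff ?e")
proof -
  have zc: "norm (x - z * x) \<le> norm x" for x using z by (simp add: damping_def)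
  have s: "star ?e = ?e" by (simp add: star_add star_diff star_mult star_star)
  have con: "norm (x - ?e * x) \<le> norm x" for x
  proof -
    have "x - ?e * x = (x - star z * x) - z * (x - star z * x)" by (simp add: algebra_simps)
    then show ?thesis
      using zc multiplier_adjoint_contraction[OF zc] by (metis order_trans)
  qed
  \<comment> \<open>The norm of \<open>e\<^sup>2\<close> is the square of the norm of \<open>e\<close>, while \<open>e - e\<^sup>2\<close> is no larger than \<open>e\<close>.\<close>
  have "norm ?e \<le> 2"
  proof (cases "?e = 0")
    case False
    have "(norm ?e)\<^sup>2 = norm (?e - (?e - ?e * ?e))"
      using cstar_identity[of ?e] by (simp add: s)
    also have "\<dots> \<le> norm ?e + norm (?e - ?e * ?e)" by (rule norm_triangle_ineq4)
    also have "\<dots> \<le> 2 * norm ?e" using con[of ?e] by simp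
    finally show ?thesis using False by (simp add: power2_eq_square)
  qed simp
  moreover have "(norm (p ?e \<xi>))\<^sup>2 \<le> Re (cinner \<xi> (p ?e \<xi>))" for \<xi>
  proof -
    let ?u = "\<xi> - p (star z) \<xi>"
    have eq: "\<xi> - p ?e \<xi> = ?u - p z ?u"
      by (simp add: p_add p_diff p_mult p_vec_diff)
    have "Re (cinner \<xi> (\<xi> - p ?e \<xi>)) = (norm ?u)\<^sup>2"
    proof -
      have *: "cinner (p (star z) \<xi>) ?u = cinner \<xi> (p z ?u)" by (rule p_adjoint')
      have "cinner \<xi> ?u = cinner ?u ?u + cinner (p (star z) \<xi>) ?u"
        by (simp flip: cinner_add_left)
      then have "cinner \<xi> (?u - p z ?u) = cinner ?u ?u"
        by (simp add: cinner_diff_right[of \<xi> ?u] *)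
      then show ?thesis by (simp add: eq cinner_self)
    qed
    moreover have "norm (\<xi> - p ?e \<xi>) \<le> norm ?u"
      unfolding eq using z by (simp add: damping_def)
    then have "(norm (\<xi> - p ?e \<xi>))\<^sup>2 \<le> (norm ?u)\<^sup>2" by (intro power_mono) auto
    ultimately show ?thesis
      by (simp add: norm_diff_square cinner_diff_right cinner_self)
  qed
  moreover have "chi ?e = 0" using z by (simp add: damping_def chi_add chi_diff chi_mult)
  ultimately show ?thesis using s con by (simp add: cutoff_def)
qed

lemma cutoff_exists:
  assumes "finite F" and "\<And>a. a \<in> F \<Longrightarrow> chi (star a * a) = 0" and "0 < e"
  obtains w where "cutoff w" "\<And>a. a \<in> F \<Longrightarrow> norm (a - a * w) \<le> e"
proof -
  obtain z where z: "damping z" "\<forall>a\<in>F. norm (a - a * z) \<le> e"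
    using damping_finite[OF assms] by blast
  let ?e = "z + star z - z * star z"
  have "norm (a - a * ?e) \<le> e" if "a \<in> F" for a
  proof -
    have "a - a * ?e = (a - a * z) - (a - a * z) * star z" by (simp add: algebra_simps)
    then have "norm (a - a * ?e) \<le> norm (a - a * z)"
      using multiplier_right_contraction(2)[of z "a - a * z"] z(1) by (simp only: damping_def)
    with z(2) that show ?thesis by fastforce
  qed
  with that cutoff_of_damping[OF z(1)] show thesis by blast
qed

section \<open>Factorization of null sequences\<close>

text \<open>
  One step of Cohen factorization. The current right factor is \<open>t + \<kappa>\<close> in the unitization of the kernel;
  it is multiplied from the left by \<open>q = (1 + e)/2\<close>, and each \<open>x n\<close> is replaced by \<open>x n q\<^sup>-\<^sup>1\<close>, which is the
  fixed point of \<open>y \<mapsto> x n + y (1 - e)/2\<close>. Both changes are small if \<open>e\<close> almost fixes all \<open>x n\<close> from the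
  right and \<open>\<kappa>\<close> from the left. Finitely many conditions ensure this: the tail of \<open>x\<close> is small already, and
  the condition on \<open>\<kappa>\<close> is one on its adjoint. The scalar \<open>t\<close> is halved, so that the limit of the right
  factors lies in the kernel.
\<close>

lemma factor_step:
  fixes x :: "nat \<Rightarrow> 'a" and t :: real
  assumes chix: "\<And>n. chi (x n) = 0" and x0: "x \<longlonglongrightarrow> 0" and chik: "chi \<kappa> = 0" and t: "0 < t"
  obtains x' \<kappa>' where "\<And>n. chi (x' n) = 0" "x' \<longlonglongrightarrow> 0" "chi \<kappa>' = 0"
    "\<And>n. norm (x' n - x n) \<le> t" "norm (\<kappa>' - \<kappa>) \<le> 2 * t"
    "\<And>n. t *\<^sub>R x n + x n * \<kappa> = (t / 2) *\<^sub>R x' n + x' n * \<kappa>'"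
proof -
  obtain N where N: "\<And>n. n \<ge> N \<Longrightarrow> norm (x n) < t"
    using LIMSEQ_D[OF x0 t] by auto
  \<comment> \<open>For \<open>b = star \<kappa>\<close> the product \<open>star b * b\<close> is \<open>\<kappa> * star \<kappa>\<close>, on which \<open>chi\<close> vanishes with \<open>chi \<kappa>\<close>.\<close>
  obtain e where e: "cutoff e" and F: "\<And>b. b \<in> insert (star \<kappa>) (x ` {..<N}) \<Longrightarrow> norm (b - b * e) \<le> t"
    by (rule cutoff_exists[of "insert (star \<kappa>) (x ` {..<N})" t])
      (use t chix chik in \<open>auto simp: chi_mult star_star\<close>)
  have xe: "norm (x n - x n * e) \<le> t" for n
  proof (cases "n < N")
    case False
    then show ?thesis using N[of n] cutoff_right[OF e, of "x n"] by simp
  qed (use F in auto)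
  have "norm (star (\<kappa> - e * \<kappa>)) \<le> t"
    using F[of "star \<kappa>"] e by (simp add: star_diff star_mult cutoff_def)
  then have ek: "norm (\<kappa> - e * \<kappa>) \<le> t" by (simp only: norm_star)
  have "\<exists>y. x n + (1/2) *\<^sub>R (y - y * e) = y" for n
  proof -
    obtain y where "x n + (1/2) *\<^sub>R (y - y * e) = y"
    proof (rule affine_fixpoint[of "1/2" "\<lambda>y. x n + (1/2) *\<^sub>R (y - y * e)"])
      fix y z
      have "x n + (1/2) *\<^sub>R (y - y * e) - (x n + (1/2) *\<^sub>R (z - z * e)) = (1/2) *\<^sub>R ((y - z) - (y - z) * e)"
        by (simp add: algebra_simps)
      then show "norm (x n + (1/2) *\<^sub>R (y - y * e) - (x n + (1/2) *\<^sub>R (z - z * e))) \<le> 1/2 * norm (y - z)"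
        using cutoff_right[OF e, of "y - z"] by simp
    qed simp_all
    then show ?thesis by blast
  qed
  then obtain x' where x': "\<And>n. x n + (1/2) *\<^sub>R (x' n - x' n * e) = x' n" by metis
  define \<kappa>' where "\<kappa>' = (1/2) *\<^sub>R \<kappa> + (t/2) *\<^sub>R e + (1/2) *\<^sub>R (e * \<kappa>)"
  have diff: "x' n - x n = (1/2) *\<^sub>R (x' n - x' n * e)" for n
    using x'[of n] by (simp add: algebra_simps)
  have chie: "chi e = 0" using e by (simp add: cutoff_def)
  have "chi (x' n) = 0" for n
  proof -
    have "chi (x' n - x n) = chi (x' n) / 2"
      unfolding diff by (simp add: chi_scaleR chi_diff chi_mult chie)
    then show ?thesis by (simp add: chi_diff chix)
  qed
  moreover have "x' \<longlonglongrightarrow> 0"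
  proof (rule Lim_null_comparison)
    show "\<forall>\<^sub>F n in sequentially. norm (x' n) \<le> 2 * norm (x n)"
    proof (intro always_eventually allI)
      fix n
      have "norm (x' n) \<le> norm (x n) + norm (x' n - x n)"
        using norm_triangle_ineq[of "x n" "x' n - x n"] by simp
      also have "\<dots> \<le> norm (x n) + (1/2) * norm (x' n)"
        using cutoff_right[OF e, of "x' n"] by (simp add: diff)
      finally show "norm (x' n) \<le> 2 * norm (x n)" by simp
    qed
    show "(\<lambda>n. 2 * norm (x n)) \<longlonglongrightarrow> 0"
      using tendsto_mult_right_zero[OF tendsto_norm_zero[OF x0]] .
  qed
  moreover have "chi \<kappa>' = 0"
    by (simp add: \<kappa>'_def chi_add chi_scaleR chi_mult chik chie)
  moreover have "norm (x' n - x n) \<le> t" for n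
  proof -
    let ?r = "x' n - x n"
    have "2 *\<^sub>R ?r = x' n - x' n * e" by (simp add: diff)
    also have "\<dots> = (x n - x n * e) + (?r - ?r * e)" by (simp add: algebra_simps)
    finally have "2 * norm ?r = norm ((x n - x n * e) + (?r - ?r * e))"
      by (metis norm_scaleR abs_numeral)
    also have "\<dots> \<le> t + norm ?r"
      using norm_triangle_mono[OF xe[of n] cutoff_right[OF e, of ?r]] .
    finally show ?thesis by simp
  qed
  moreover have "norm (\<kappa>' - \<kappa>) \<le> 2 * t"
  proof -
    have "\<kappa> = (1/2) *\<^sub>R \<kappa> + (1/2) *\<^sub>R \<kappa>" by (simp flip: scaleR_left.add)
    then have "\<kappa>' - \<kappa> = (t/2) *\<^sub>R e - (1/2) *\<^sub>R (\<kappa> - e * \<kappa>)"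
      unfolding \<kappa>'_def by (simp add: algebra_simps)
    then have "norm (\<kappa>' - \<kappa>) \<le> norm ((t/2) *\<^sub>R e) + norm ((1/2) *\<^sub>R (\<kappa> - e * \<kappa>))"
      by (metis norm_triangle_ineq4)
    also have "\<dots> \<le> t/2 * 2 + 1/2 * t"
      using e ek t by (intro add_mono) (auto simp: cutoff_def)
    finally show ?thesis using t by simp
  qed
  moreover have "t *\<^sub>R x n + x n * \<kappa> = (t / 2) *\<^sub>R x' n + x' n * \<kappa>'" for n
  proof -
    have "x n = x' n - (1/2) *\<^sub>R (x' n - x' n * e)" using diff[of n] by (simp add: algebra_simps)
    also have "\<dots> = (1/2) *\<^sub>R x' n + (1/2) *\<^sub>R (x' n * e)"
      by (simp add: scaleR_diff_right) (simp flip: scaleR_left.add add: add.commute diff_eq_eq)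
    finally have "x n = (1/2) *\<^sub>R x' n + (1/2) *\<^sub>R (x' n * e)" .
    then show ?thesis
      by (simp add: \<kappa>'_def algebra_simps)
  qed
  ultimately show thesis by (rule that)
qed

lemma null_sequence_factorization:
  fixes a :: "nat \<Rightarrow> 'a"
  assumes chia: "\<And>n. chi (a n) = 0" and a0: "a \<longlonglongrightarrow> 0"
  obtains c d where "chi d = 0" "\<And>n. a n = c n * d" "\<And>n. norm (c n) \<le> norm (a n) + 2"
proof -
  define P where "P k X \<longleftrightarrow> (\<forall>n. chi (fst X n) = 0) \<and> fst X \<longlonglongrightarrow> 0 \<and> chi (snd X) = 0
      \<and> (\<forall>n. a n = (1/2)^k *\<^sub>R fst X n + fst X n * snd X) \<and> (k = 0 \<longrightarrow> fst X = a)"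
    for k :: nat and X :: "(nat \<Rightarrow> 'a) \<times> 'a"
  define Q where "Q k X Y \<longleftrightarrow> (\<forall>n. norm (fst Y n - fst X n) \<le> (1/2)^k)
      \<and> norm (snd Y - snd X) \<le> 2 * (1/2)^k"
    for k :: nat and X Y :: "(nat \<Rightarrow> 'a) \<times> 'a"
  have "\<exists>f. \<forall>k. P k (f k) \<and> Q k (f k) (f (Suc k))"
  proof (rule dependent_nat_choice)
    have "chi 0 = 0" using chi_add[of 0 0] by simp
    then show "\<exists>X. P 0 X"
      by (intro exI[of _ "(a, 0)"]) (simp add: P_def chia a0)
  next
    fix X k
    assume X: "P k X"
    have t: "0 < (1/2::real)^k" by simp
    obtain x' \<kappa>' where "\<And>n. chi (x' n) = 0" "x' \<longlonglongrightarrow> 0" "chi \<kappa>' = 0"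
      "\<And>n. norm (x' n - fst X n) \<le> (1/2)^k" "norm (\<kappa>' - snd X) \<le> 2 * (1/2)^k"
      "\<And>n. (1/2)^k *\<^sub>R fst X n + fst X n * snd X = ((1/2)^k / 2) *\<^sub>R x' n + x' n * \<kappa>'"
      using X by (elim factor_step[of "fst X" "snd X" "(1/2)^k", rotated 4]) (auto simp: P_def)
    then show "\<exists>Y. P (Suc k) Y \<and> Q k X Y"
      using X by (intro exI[of _ "(x', \<kappa>')"]) (simp add: P_def Q_def)
  qed
  then obtain f where P: "\<And>k. P k (f k)" and Q: "\<And>k. Q k (f k) (f (Suc k))" by blast
  obtain d where d: "(\<lambda>k. snd (f k)) \<longlonglongrightarrow> d"
    by (rule geometric_increments[of "\<lambda>k. snd (f k)" 2]) (use Q in \<open>auto simp: Q_def\<close>)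
  have "\<exists>l. (\<lambda>k. fst (f k) n) \<longlonglongrightarrow> l \<and> norm (l - a n) \<le> 2" for n
  proof -
    have "fst (f 0) = a" using P[of 0] by (simp add: P_def)
    moreover have "norm (fst (f (Suc k)) n - fst (f k) n) \<le> 1 * (1/2)^k" for k
      using Q[of k] by (simp add: Q_def)
    then obtain l where "(\<lambda>k. fst (f k) n) \<longlonglongrightarrow> l" "norm (l - fst (f 0) n) \<le> 2 * 1"
      by (rule geometric_increments)
    ultimately show ?thesis by auto
  qed
  then obtain c where c: "\<And>n. (\<lambda>k. fst (f k) n) \<longlonglongrightarrow> c n" and ca: "\<And>n. norm (c n - a n) \<le> 2"
    by metis
  have "chi d = 0"
  proof -
    have "(\<lambda>k. chi (snd (f k))) \<longlonglongrightarrow> chi d" by (rule bounded_linear.tendsto[OF chi_bounded_linear d])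
    moreover have "(\<lambda>k. chi (snd (f k))) = (\<lambda>k. 0)" using P by (auto simp: P_def)
    ultimately show ?thesis by (simp add: LIMSEQ_const_iff)
  qed
  moreover have "a n = c n * d" for n
  proof -
    have "(\<lambda>k. (1/2::real)^k *\<^sub>R fst (f k) n + fst (f k) n * snd (f k)) \<longlonglongrightarrow> 0 *\<^sub>R c n + c n * d"
      by (intro tendsto_add tendsto_scaleR tendsto_mult c d LIMSEQ_power_zero) simp
    moreover have "(\<lambda>k. (1/2::real)^k *\<^sub>R fst (f k) n + fst (f k) n * snd (f k)) = (\<lambda>k. a n)"
      using P by (auto simp: P_def)
    ultimately show ?thesis by (simp add: LIMSEQ_const_iff)
  qed
  moreover have "norm (c n) \<le> norm (a n) + 2" for n
    using norm_triangle_ineq[of "a n" "c n - a n"] ca[of n] by simp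
  ultimately show thesis by (rule that)
qed

end

section \<open>Derivations relative to a character\<close>

locale point_derivation = rep_with_functional p chi
  for p :: "'a::cstar_algebra \<Rightarrow> 'h::chilbert_space \<Rightarrow> 'h" and chi +
  fixes D :: "'a \<Rightarrow> 'h"
  assumes D_add: "D (a + b) = D a + D b"
    and D_scaleC: "D (c *\<^sub>C a) = c *\<^sub>C D a"
    and D_mult: "D (a * b) = chi b *\<^sub>C D a + p a (D b)"
begin

lemma D_diff: "D (a - b) = D a - D b"
  using D_add[of "a - b" b] by (simp add: algebra_simps)

lemma D_scaleR: "D (r *\<^sub>R a) = r *\<^sub>R D a"
  by (simp add: scaleR_scaleC D_scaleC)

lemma D_module: "chi b = 0 \<Longrightarrow> D (a * b) = p a (D b)"
  by (simp add: D_mult)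

text \<open>
  An unbounded \<open>D\<close> would be unbounded along some null sequence; a common right factor \<open>d\<close> of that
  sequence bounds its image by a multiple of the norm of \<open>D d\<close>.
\<close>

lemma D_bounded_on_kernel:
  obtains C where "0 \<le> C" "\<And>a. chi a = 0 \<Longrightarrow> norm (D a) \<le> C * norm a"
proof -
  have False if no: "\<nexists>C. 0 \<le> C \<and> (\<forall>a. chi a = 0 \<longrightarrow> norm (D a) \<le> C * norm a)"
  proof -
    have "\<exists>b. chi b = 0 \<and> norm b \<le> 1 / Suc n \<and> norm (D b) \<ge> Suc n" for n
    proof -
      let ?m = "real (Suc n)"
      obtain a where a: "chi a = 0" "norm (D a) > ?m\<^sup>2 * norm a"
        using no zero_le_power2[of ?m] by (metis not_le)
      have "D 0 = 0" using D_diff[of 0 0] by simp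
      with a have na: "norm a > 0" by auto
      \<comment> \<open>The square leaves a factor \<open>?m\<close> after \<open>a\<close> is rescaled to norm \<open>1 / ?m\<close>.\<close>
    define b where "b = (1 / (?m * norm a)) *\<^sub>R a"
      have "norm b = 1 / ?m" using na by (simp add: b_def del: of_nat_Suc)
      moreover have "norm (D b) = norm (D a) / (?m * norm a)"
        by (simp add: b_def D_scaleR)
      then have "?m \<le> norm (D b)"
        using a(2) na by (simp add: pos_le_divide_eq power2_eq_square mult.assoc)
      ultimately show ?thesis using a(1) by (intro exI[of _ b]) (simp add: b_def chi_scaleR)
    qed
    then obtain b where b: "\<And>n. chi (b n) = 0" "\<And>n. norm (b n) \<le> 1 / Suc n"
      "\<And>n. norm (D (b n)) \<ge> Suc n" by metis
    have "b \<longlonglongrightarrow> 0"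
      by (rule Lim_null_comparison[OF _ LIMSEQ_inverse_real_of_nat])
        (use b(2) in \<open>simp add: inverse_eq_divide\<close>)
    then obtain c d where cd: "chi d = 0" "\<And>n. b n = c n * d" "\<And>n. norm (c n) \<le> norm (b n) + 2"
      using null_sequence_factorization[of b] b(1) by metis
    have bound: "Suc n \<le> 3 * norm (D d)" for n
    proof -
      have "norm (c n) \<le> 3"
      proof -
        have "1 / real (Suc n) \<le> 1" by simp
        then show ?thesis using cd(3)[of n] b(2)[of n] by linarith
      qed
      then have "norm (c n) * norm (D d) \<le> 3 * norm (D d)" by (intro mult_right_mono) auto
      moreover have "norm (D (b n)) \<le> norm (c n) * norm (D d)"
        unfolding cd(2) D_module[OF cd(1)] by (rule p_contractive)
      ultimately show ?thesis using b(3)[of n] by linarith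
    qed
    obtain n where "3 * norm (D d) < real n" using reals_Archimedean2 by blast
    with bound[of n] show False by simp
  qed
  then show thesis using that by blast
qed

text \<open>
  The vector is the limit of a maximizing sequence for the norm of \<open>D\<close> on cutoffs. Continuity of \<open>D\<close>
  enters twice: it makes the supremum finite, and it turns \<open>b v\<close> close to \<open>b\<close> into \<open>p b (D v)\<close> close to
  \<open>D b\<close>.
\<close>

lemma inner_on_kernel:
  obtains T where "\<And>a. chi a = 0 \<Longrightarrow> D a = p a T"
proof -
  obtain C where C: "0 \<le> C" "\<And>a. chi a = 0 \<Longrightarrow> norm (D a) \<le> C * norm a"
    using D_bounded_on_kernel by blast
  define S where "S = (\<lambda>u. norm (D u)) ` {u. cutoff u}"
  define M where "M = Sup S"
  have bdd: "bdd_above S"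
  proof (rule bdd_aboveI)
    fix r assume "r \<in> S"
    then obtain u where u: "cutoff u" "r = norm (D u)" by (auto simp: S_def)
    then have "r \<le> C * norm u" using C(2) by (simp add: cutoff_def)
    also have "\<dots> \<le> C * 2" using u C(1) by (intro mult_left_mono) (auto simp: cutoff_def)
    finally show "r \<le> C * 2" .
  qed
  have M: "norm (D u) \<le> M" if "cutoff u" for u
    unfolding M_def by (rule cSup_upper[OF _ bdd]) (use that in \<open>auto simp: S_def\<close>)
  obtain u0 where u0: "cutoff u0"
    using cutoff_exists[of "{}" 1] by auto
  then have ne: "S \<noteq> {}" by (auto simp: S_def)
  have M0: "0 \<le> M" by (rule order_trans[OF norm_ge_zero M[OF u0]])
  have "\<exists>u. cutoff u \<and> M - \<epsilon> < norm (D u)" if "0 < \<epsilon>" for \<epsilon>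
    using less_cSupE[of "M - \<epsilon>" S] ne that unfolding M_def by (auto simp: S_def)
  then have "\<exists>u. cutoff u \<and> M - 1 / Suc n < norm (D u)" for n by simp
  then obtain u where u: "\<And>n. cutoff (u n)" "\<And>n. M - 1 / Suc n < norm (D (u n))" by metis
  have approx: "\<exists>v. cutoff v \<and> (\<forall>b\<in>F. norm (D b - p b (D v)) \<le> e)"
    if F: "finite F" "\<And>b. b \<in> F \<Longrightarrow> chi b = 0" and e: "0 < e" for F e
  proof -
    obtain v where v: "cutoff v" "\<And>b. b \<in> F \<Longrightarrow> norm (b - b * v) \<le> e / (C + 1)"
      by (rule cutoff_exists[of F "e / (C + 1)"]) (use F e C(1) in \<open>auto simp: chi_mult\<close>)
    have "norm (D b - p b (D v)) \<le> e" if b: "b \<in> F" for b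
    proof -
      have cv: "chi v = 0" using v by (simp add: cutoff_def)
      have "norm (D (b - b * v)) \<le> C * norm (b - b * v)"
        using F(2)[OF b] cv by (intro C(2)) (simp add: chi_diff chi_mult)
      also have "\<dots> \<le> (C + 1) * (e / (C + 1))"
        using v(2)[OF b] C(1) by (intro mult_mono) auto
      finally show ?thesis using C(1) by (simp add: D_diff D_module[OF cv])
    qed
    with v(1) show ?thesis by blast
  qed
  \<comment> \<open>For \<open>\<xi> = D v\<close> the condition \<open>w\<^sup>2 \<le> w\<close> bounds the squared norm of \<open>\<xi> - w \<xi>\<close> by the
    difference of the squared norms of \<open>\<xi>\<close> and \<open>w \<xi>\<close>; the former norm is at most \<open>M\<close>, the latter at least \<open>M - 2 s\<close>.\<close>
  have close: "(norm (D v - p w (D v)))\<^sup>2 \<le> 4 * M * s"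
    if v: "cutoff v" and w: "cutoff w"
      and s: "M - s < norm (D w)" "norm (D w - p w (D v)) \<le> s" "0 < s" for v w s
  proof -
    have "norm (D w) \<le> norm (p w (D v)) + norm (D w - p w (D v))"
      using norm_triangle_ineq[of "p w (D v)" "D w - p w (D v)"] by simp
    then have lower: "M - 2 * s \<le> norm (p w (D v))" using s by linarith
    have sq: "M\<^sup>2 - 4 * M * s \<le> (norm (p w (D v)))\<^sup>2"
    proof (cases "M - 2 * s \<ge> 0")
      case True
      have "M\<^sup>2 - 4 * M * s \<le> (M - 2 * s)\<^sup>2" by (simp add: power2_eq_square algebra_simps)
      also have "\<dots> \<le> (norm (p w (D v)))\<^sup>2" using lower True by (intro power_mono)
      finally show ?thesis .
    next
      case False
      then have "M * M \<le> M * (4 * s)" using M0 s by (intro mult_left_mono) auto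
      then have "M\<^sup>2 - 4 * M * s \<le> 0" by (simp add: power2_eq_square algebra_simps)
      then show ?thesis using zero_le_power2 order_trans by blast
    qed
    have "(norm (p w (D v)))\<^sup>2 \<le> Re (cinner (D v) (p w (D v)))" using w by (simp add: cutoff_def)
    then have "(norm (D v - p w (D v)))\<^sup>2 \<le> (norm (D v))\<^sup>2 - (norm (p w (D v)))\<^sup>2"
      by (simp add: norm_diff_square)
    also have "\<dots> \<le> M\<^sup>2 - (norm (p w (D v)))\<^sup>2" using M[OF v] by (simp add: power_mono)
    finally show ?thesis using sq by linarith
  qed
  define \<rho> where "\<rho> n = sqrt (4 * M * (1 / Suc n)) + 1 / Suc n" for n
  have near: "norm (D v - D (u n)) \<le> \<rho> n"
    if "cutoff v" "norm (D (u n) - p (u n) (D v)) \<le> 1 / Suc n" for v n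
  proof -
    have "norm (D v - p (u n) (D v)) \<le> sqrt (4 * M * (1 / Suc n))"
      using close[OF that(1) u(1) u(2) that(2)] by (intro real_le_rsqrt) simp
    then have "norm ((D v - p (u n) (D v)) - (D (u n) - p (u n) (D v))) \<le> \<rho> n"
      unfolding \<rho>_def using that(2) norm_triangle_ineq4 order_trans add_mono by meson
    then show ?thesis by simp
  qed
  have rho: "\<rho> \<longlonglongrightarrow> 0"
  proof -
    have i: "(\<lambda>n. 1 / real (Suc n)) \<longlonglongrightarrow> 0"
      using LIMSEQ_inverse_real_of_nat by (simp add: inverse_eq_divide)
    have "(\<lambda>n. sqrt (4 * M * (1 / Suc n)) + 1 / Suc n) \<longlonglongrightarrow> sqrt (4 * M * 0) + 0"
      by (intro tendsto_intros i)
    then show ?thesis by (simp add: \<rho>_def[abs_def])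
  qed
  have ku: "chi (u n) = 0" for n using u(1) by (simp add: cutoff_def)
  have uu: "norm (D (u m) - D (u n)) \<le> \<rho> m + \<rho> n" for m n
  proof -
    obtain v where v: "cutoff v"
      "\<forall>b\<in>{u m, u n}. norm (D b - p b (D v)) \<le> min (1 / Suc m) (1 / Suc n)"
      using approx[of "{u m, u n}" "min (1 / Suc m) (1 / Suc n)"] ku by auto
    then have "norm (D v - D (u m)) \<le> \<rho> m" "norm (D v - D (u n)) \<le> \<rho> n"
      by (auto intro!: near)
    then show ?thesis
      using norm_triangle_ineq4[of "D v - D (u n)" "D v - D (u m)"] by simp
  qed
  have "Cauchy (\<lambda>n. D (u n))"
  proof (rule CauchyI)
    fix e :: real assume "0 < e"
    then obtain N where N: "\<And>n. n \<ge> N \<Longrightarrow> \<rho> n < e / 2"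
      using order_tendstoD(2)[OF rho, of "e / 2"] by (auto simp: eventually_sequentially)
    have "norm (D (u m) - D (u n)) < e" if "m \<ge> N" "n \<ge> N" for m n
      using uu[of m n] N[OF that(1)] N[OF that(2)] by linarith
    then show "\<exists>N. \<forall>m\<ge>N. \<forall>n\<ge>N. norm (D (u m) - D (u n)) < e" by blast
  qed
  then obtain T where T: "(\<lambda>n. D (u n)) \<longlonglongrightarrow> T"
    using Cauchy_convergent_iff convergent_def by blast
  have "D a = p a T" if a: "chi a = 0" for a
  proof -
    have "norm (D a - p a (D (u n))) \<le> 1 / Suc n + norm a * \<rho> n" for n
    proof -
      obtain v where v: "cutoff v" "\<forall>b\<in>{a, u n}. norm (D b - p b (D v)) \<le> 1 / Suc n"
        using approx[of "{a, u n}" "1 / Suc n"] ku a by auto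
      have "norm (p a (D v - D (u n))) \<le> norm a * \<rho> n"
        by (rule order_trans[OF p_contractive mult_left_mono[OF near]]) (use v in auto)
      then have "norm ((D a - p a (D v)) + p a (D v - D (u n))) \<le> 1 / Suc n + norm a * \<rho> n"
        using v(2) by (intro norm_triangle_mono) auto
      then show ?thesis by (simp add: p_vec_diff)
    qed
    moreover have "(\<lambda>n. 1 / Suc n + norm a * \<rho> n) \<longlonglongrightarrow> 0 + norm a * 0"
      using LIMSEQ_inverse_real_of_nat
      by (intro tendsto_intros rho) (simp add: inverse_eq_divide)
    ultimately have "(\<lambda>n. D a - p a (D (u n))) \<longlonglongrightarrow> 0"
      by (simp add: Lim_null_comparison[where g = "\<lambda>n. 1 / Suc n + norm a * \<rho> n"])
    moreover have "(\<lambda>n. D a - p a (D (u n))) \<longlonglongrightarrow> D a - p a T"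
      by (intro tendsto_intros bounded_linear.tendsto[OF p_bounded] T)
    ultimately show ?thesis using LIMSEQ_unique by fastforce
  qed
  then show thesis by (rule that)
qed

text \<open>
  Subtracting the inner derivation of \<open>S\<close> leaves a derivation that vanishes on the kernel, hence equals
  \<open>a \<mapsto> chi a \<xi>\<close>. The derivation rule for \<open>a e\<close>, where \<open>chi e = 1\<close>, forces \<open>p a \<xi> = 0\<close> for all \<open>a\<close>, so
  this remainder is the inner derivation of \<open>- \<xi>\<close>.
\<close>

lemma inner_on_algebra:
  assumes "chi a0 \<noteq> 0"
  obtains T where "\<And>a. D a = p a T - chi a *\<^sub>C T"
proof -
  obtain S where S: "\<And>a. chi a = 0 \<Longrightarrow> D a = p a S"
    using inner_on_kernel by blast
  define e where "e = inverse (chi a0) *\<^sub>C a0"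
  have e: "chi e = 1" using assms by (simp add: e_def chi_scaleC)
  define \<xi> where "\<xi> = D e - p e S + S"
  have decomp: "D a = p a S - chi a *\<^sub>C S + chi a *\<^sub>C \<xi>" for a
  proof -
    have "D (a - chi a *\<^sub>C e) = p (a - chi a *\<^sub>C e) S"
      by (rule S) (simp add: chi_diff chi_scaleC e)
    then show ?thesis
      by (simp add: \<xi>_def D_diff D_scaleC p_diff p_scaleC algebra_simps)
  qed
  have "p a \<xi> = 0" for a
  proof -
    have "D (a * e) = D a + p a (D e)" by (simp add: D_mult e scaleC_one)
    moreover have "D e = p e S - S + \<xi>" using decomp[of e] by (simp add: e scaleC_one)
    ultimately have "p a (p e S) - chi a *\<^sub>C S + chi a *\<^sub>C \<xi>
        = p a S - chi a *\<^sub>C S + chi a *\<^sub>C \<xi> + (p a (p e S) - p a S + p a \<xi>)"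
      using decomp[of "a * e"] decomp[of a]
      by (simp add: chi_mult e p_mult p_vec_diff linear_add[OF bounded_linear.linear[OF p_bounded]])
    then show ?thesis by (simp add: algebra_simps)
  qed
  then have "D a = p a (S - \<xi>) - chi a *\<^sub>C (S - \<xi>)" for a
    using decomp[of a] by (simp add: p_vec_diff algebra_simps)
  then show thesis by (rule that)
qed

end

theorem theoremA4:
  fixes \<pi> :: "'a::cstar_algebra \<Rightarrow> ('h::chilbert_space \<Rightarrow>\<^sub>C\<^sub>L 'h)"
    and chi :: "'a \<Rightarrow> complex"
    and \<delta> :: "'a \<Rightarrow> (complex \<Rightarrow>\<^sub>C\<^sub>L 'h)"
  assumes "star_representation \<pi>"
    and "character chi"
    and "derivation \<pi> chi \<delta>"
  shows "inner_derivation \<pi> chi \<delta>"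
proof -
  have lin: "clinear \<pi>" "clinear chi" "clinear \<delta>"
    using assms by (simp_all add: star_representation_def character_def derivation_def)
  interpret pi: Vector_Spaces.linear scaleC scaleC \<pi> by (rule lin)
  interpret chi: Vector_Spaces.linear scaleC scaleC chi by (rule lin)
  interpret delta: Vector_Spaces.linear scaleC scaleC \<delta> by (rule lin)
  let ?p = "\<lambda>a. cblinfun_apply (\<pi> a)" and ?D = "\<lambda>a. cblinfun_apply (\<delta> a) 1"
  note ops = plus_cblinfun.rep_eq scaleC_cblinfun.rep_eq cblinfun_compose.rep_eq
  interpret point_derivation ?p chi ?D
  proof (intro point_derivation.intro rep_with_functional.intro point_derivation_axioms.intro)
    show "bounded_linear (?p a)" for a
      using cblinfun_apply[of "\<pi> a"] by (simp add: bounded_clinear_def)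
    show "?p (a * b) \<xi> = ?p a (?p b \<xi>)" for a b \<xi>
      using assms(1) by (simp add: star_representation_def ops)
    show "cinner (?p a \<xi>) \<eta> = cinner \<xi> (?p (star a) \<eta>)" for a \<xi> \<eta>
      using assms(1) by (simp add: star_representation_def is_adjoint_def)
    show "chi (a * b) = chi a * chi b" for a b
      using assms(2) by (simp add: character_def)
    show "?D (a * b) = chi b *\<^sub>C ?D a + ?p a (?D b)" for a b
      using assms(3) by (simp add: derivation_def ops)
  qed (simp_all add: pi.add pi.scale chi.add chi.scale delta.add delta.scale ops scaleC_complex_def)
  obtain a0 where "chi a0 \<noteq> 0" using assms(2) by (auto simp: character_def)
  then obtain t where t: "\<And>a. ?D a = ?p a t - chi a *\<^sub>C t"
    using inner_on_algebra by blast
  have hom: "cblinfun_apply f (c *\<^sub>C x) = c *\<^sub>C cblinfun_apply f x"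
    for f :: "'b::complex_normed_vector \<Rightarrow>\<^sub>C\<^sub>L 'c::complex_normed_vector" and c x
    using cblinfun_apply[of f] by (simp add: bounded_clinear_def)
  define T where "T = CBlinfun (\<lambda>z. z *\<^sub>C t)"
  have "bounded_clinear (\<lambda>z::complex. z *\<^sub>C t)"
    unfolding bounded_clinear_def
    by (auto intro!: bounded_linear_intro[where K = "norm t"]
        simp: scaleC_add_left scaleR_scaleC scaleC_scaleC norm_scaleC scaleC_complex_def scaleR_conv_of_real)
  then have T: "cblinfun_apply T = (\<lambda>z. z *\<^sub>C t)"
    unfolding T_def by (intro CBlinfun_inverse) simp
  have "\<delta> a = \<pi> a o\<^sub>C T - chi a *\<^sub>C T" for a
  proof (rule cblinfun_apply_inject[THEN iffD1], rule ext)
    fix z :: complex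
    have "cblinfun_apply (\<delta> a) z = z *\<^sub>C ?D a"
      using hom[of "\<delta> a" z 1] by (simp add: scaleC_complex_def)
    also have "\<dots> = cblinfun_apply (\<pi> a o\<^sub>C T - chi a *\<^sub>C T) z"
      by (simp add: t ops minus_cblinfun.rep_eq T hom complex_vector.scale_right_diff_distrib
          scaleC_scaleC mult.commute)
    finally show "cblinfun_apply (\<delta> a) z = cblinfun_apply (\<pi> a o\<^sub>C T - chi a *\<^sub>C T) z" .
  qed
  then show ?thesis unfolding inner_derivation_def by blast
qed

end
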